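(* Let $N\ge 1$ and let $q$ be a norm on $\mathbb{P}(\mathbb{C}^N)$ which is spectral admissible with respect to some spectral norm $q_\sigma$ on $\mathbb{P}(\mathbb{C}^N)$. Then $$m^*(q)=\lim_{k\to\infty}\frac{1}{k}m_k(q)=m(q_\sigma)$$ (in particular the limit exists). In particular, $m(q_\sigma)\le m(q)$.
   Context: $\mathbb{P}(\mathbb{C}^N)$ is the complex vector space of all polynomials in $N$ variables with complex coefficients, and $\deg P$ is the total degree. A norm $q_\sigma$ on $\mathbb{P}(\mathbb{C}^N)$ is called spectral if $q_\sigma(P^n)=(q_\sigma(P))^n$ for every $P\in\mathbb{P}(\mathbb{C}^N)$ and every integer $n\ge1$. A norm $q$ on $\mathbb{P}(\mathbb{C}^N)$ is spectral admissible (has the generalized Nikolskii property) with respect to a spectral norm $q_\sigma$ if there exist constants $A,B>0$ and $a,b\ge 0$ such that for every $P\in\mathbb{P}(\mathbb{C}^N)$ with $\deg P\ge1$, $$q_\sigma(P)\le A(\deg P)^a q(P)\quad\text{and}\quad q(P)\le B(\deg P)^b q_\sigma(P).$$ For a norm $q$ on $\mathbb{P}(\mathbb{C}^N)$ and a multi-index $\alpha\in\mathbb{Z}_{\ge0}^N$ with $|\alpha|=\alpha_1+\dots+\alpha_N\ge1$, let $D^\alpha=\partial^{|\alpha|}/\partial x_1^{\alpha_1}\cdots\partial x_N^{\alpha_N}$ and $$m(\alpha,q)=\inf\{s>0:\ \exists M>0\ \forall P\in\mathbb{P}(\mathbb{C}^N)\ \ q(D^\alpha P)\le M(\deg P)^s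 q(P)\},$$ with $\inf\emptyset=+\infty$. For $k\ge1$ put $m_k(q)=\max\{m(\alpha,q):|\alpha|=k\}$. Markov's exponent of $q$ is $m(q)=m_1(q)$. The asymptotic exponent of $q$ is $m^*(q)=\limsup_{k\to\infty}\frac1k m_k(q)$. *)

theory Defs
  imports Complex_Main "HOL-Library.FuncSet" "HOL-Library.Poly_Mapping" "HOL-Library.Extended_Real"
begin

text \<open>
  Polynomials in \<open>N = CARD('n)\<close> variables, as finitely supported maps from multi-indices to
  coefficients, with the convolution product provided by the library.
\<close>

type_synonym 'n cpoly = "('n \<Rightarrow>\<^sub>0 nat) \<Rightarrow>\<^sub>0 complex"

definition mlen :: "('n::finite \<Rightarrow>\<^sub>0 nat) \<Rightarrow> nat" where
  "mlen \<alpha> = (\<Sum>i\<in>UNIV. Poly_Mapping.lookup \<alpha> i)"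

text \<open>The zero polynomial gets degree \<open>0\<close>; its degree never matters below since norms vanish there.\<close>

definition tdeg :: "'n::finite cpoly \<Rightarrow> nat" where
  "tdeg P = Max (insert 0 (mlen ` Poly_Mapping.keys P))"

definition partial :: "'n \<Rightarrow> 'n cpoly \<Rightarrow> 'n cpoly" where
  "partial i P =
     (\<Sum>m\<in>Poly_Mapping.keys P. Poly_Mapping.single (m - Poly_Mapping.single i 1)
                     (of_nat (Poly_Mapping.lookup m i) * Poly_Mapping.lookup P m))"

text \<open>
  The operators \<open>partial i\<close> commute (lemma \<open>comp_fun_commute_partial\<close>), so the fold is the composition
  of the powers \<open>partial i ^^ \<alpha>\<^sub>i\<close> over all variables \<open>i\<close>, in any order.
\<close>

definition mderiv :: "('n::finite \<Rightarrow>\<^sub>0 nat) \<Rightarrow> 'n cpoly \<Rightarrow> 'n cpoly" where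
  "mderiv \<alpha> P = Finite_Set.fold (\<lambda>i. partial i ^^ Poly_Mapping.lookup \<alpha> i) P UNIV"

lemma lookup_partial:
  "Poly_Mapping.lookup (partial i P) m =
     of_nat (Suc (Poly_Mapping.lookup m i)) * Poly_Mapping.lookup P (m + Poly_Mapping.single i 1)"
proof -
  let ?e = "Poly_Mapping.single i (1::nat)"
  have eq: "k - ?e = m \<longleftrightarrow> k = m + ?e" if "Poly_Mapping.lookup k i \<noteq> 0" for k
  proof
    assume "k - ?e = m"
    moreover have "k - ?e + ?e = k"
      using that by (intro poly_mapping_eqI) (auto simp: lookup_add lookup_minus lookup_single when_def)
    ultimately show "k = m + ?e" by metis
  qed auto
  have "Poly_Mapping.lookup (partial i P) m =
      (\<Sum>k\<in>Poly_Mapping.keys P.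
        (of_nat (Poly_Mapping.lookup k i) * Poly_Mapping.lookup P k when k - ?e = m))"
    by (simp add: partial_def lookup_sum lookup_single)
  also have "\<dots> = (\<Sum>k\<in>Poly_Mapping.keys P.
        if k = m + ?e then of_nat (Poly_Mapping.lookup k i) * Poly_Mapping.lookup P k else 0)"
    using eq by (intro sum.cong) (auto simp: when_def)
  also have "\<dots> = of_nat (Poly_Mapping.lookup (m + ?e) i) * Poly_Mapping.lookup P (m + ?e)"
    by (auto simp: in_keys_iff)
  finally show ?thesis by (simp add: lookup_add)
qed

lemma partial_commute: "partial i (partial j P) = partial j (partial i P)"
proof (rule poly_mapping_eqI)
  fix k
  have "k + Poly_Mapping.single i 1 + Poly_Mapping.single j 1 =
        k + Poly_Mapping.single j 1 + Poly_Mapping.single i (1::nat)"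
    by (simp only: ac_simps)
  then show "Poly_Mapping.lookup (partial i (partial j P)) k =
             Poly_Mapping.lookup (partial j (partial i P)) k"
    by (cases "i = j") (simp_all add: lookup_partial lookup_add lookup_single mult.left_commute)
qed

lemma comp_fun_commute_partial: "comp_fun_commute (\<lambda>i. partial i ^^ f i)"
proof
  fix i j :: 'a
  have *: "(partial i ^^ n) (partial j P) = partial j ((partial i ^^ n) P)" for n P
    by (induction n) (auto simp: partial_commute[of i j])
  have "(partial i ^^ n) ((partial j ^^ m) P) = (partial j ^^ m) ((partial i ^^ n) P)" for n m P
    by (induction m) (auto simp: *)
  then show "partial j ^^ f j \<circ> partial i ^^ f i = partial i ^^ f i \<circ> partial j ^^ f j"
    by auto
qed

definition poly_norm :: "('n cpoly \<Rightarrow> real) \<Rightarrow> bool" where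
  "poly_norm q \<longleftrightarrow>
     (\<forall>P. 0 \<le> q P) \<and>
     (\<forall>P. q P = 0 \<longleftrightarrow> P = 0) \<and>
     (\<forall>c P. q (Poly_Mapping.map ((*) c) P) = cmod c * q P) \<and>
     (\<forall>P Q. q (P + Q) \<le> q P + q Q)"

definition spectral_norm :: "('n cpoly \<Rightarrow> real) \<Rightarrow> bool" where
  "spectral_norm q \<longleftrightarrow> poly_norm q \<and> (\<forall>P. \<forall>n\<ge>1. q (P ^ n) = q P ^ n)"

definition spectral_admissible ::
    "('n::finite cpoly \<Rightarrow> real) \<Rightarrow> ('n cpoly \<Rightarrow> real) \<Rightarrow> bool" where
  "spectral_admissible q q\<sigma> \<longleftrightarrow>
     (\<exists>A B a b. A > 0 \<and> B > 0 \<and> a \<ge> 0 \<and> b \<ge> 0 \<and>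
        (\<forall>P. tdeg P \<ge> 1 \<longrightarrow>
           q\<sigma> P \<le> A * real (tdeg P) powr a * q P \<and>
           q P \<le> B * real (tdeg P) powr b * q\<sigma> P))"

text \<open>
  Infima are taken in \<open>ereal\<close>, where \<open>Inf {} = \<infinity>\<close>. For constant \<open>P\<close> the inequality reads \<open>0 \<le> 0\<close>
  when \<open>\<alpha> \<noteq> 0\<close>, since \<open>0 powr s = 0\<close>.
\<close>

definition m_alpha :: "('n::finite \<Rightarrow>\<^sub>0 nat) \<Rightarrow> ('n cpoly \<Rightarrow> real) \<Rightarrow> ereal" where
  "m_alpha \<alpha> q =
     Inf (ereal ` {s. s > 0 \<and>
        (\<exists>M>0. \<forall>P. q (mderiv \<alpha> P) \<le> M * real (tdeg P) powr s * q P)})"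

definition m_order :: "nat \<Rightarrow> ('n::finite cpoly \<Rightarrow> real) \<Rightarrow> ereal" where
  "m_order k q = Max ((\<lambda>\<alpha>. m_alpha \<alpha> q) ` {\<alpha>. mlen \<alpha> = k})"

lemma finite_mlen_eq: "finite {\<alpha> :: 'n::finite \<Rightarrow>\<^sub>0 nat. mlen \<alpha> = k}"
proof -
  have "Poly_Mapping.lookup ` {\<alpha> :: 'n \<Rightarrow>\<^sub>0 nat. mlen \<alpha> = k} \<subseteq> PiE UNIV (\<lambda>_. {..k})"
    by (auto simp: mlen_def PiE_def Pi_def extensional_def intro!: member_le_sum)
  then have "finite (Poly_Mapping.lookup ` {\<alpha> :: 'n \<Rightarrow>\<^sub>0 nat. mlen \<alpha> = k})"
    by (rule finite_subset) (intro finite_PiE; simp)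
  then show ?thesis
    by (rule finite_imageD) (simp add: inj_on_def)
qed

lemma mlen_eq_nonempty: "{\<alpha> :: 'n::finite \<Rightarrow>\<^sub>0 nat. mlen \<alpha> = k} \<noteq> {}"
proof -
  have "mlen (Poly_Mapping.single (undefined :: 'n) k) = k"
    by (simp add: mlen_def lookup_single when_def)
  then show ?thesis by blast
qed

definition markov_exponent :: "('n::finite cpoly \<Rightarrow> real) \<Rightarrow> ereal" where
  "markov_exponent q = m_order 1 q"

definition asymptotic_exponent :: "('n::finite cpoly \<Rightarrow> real) \<Rightarrow> ereal" where
  "asymptotic_exponent q = limsup (\<lambda>k. ereal (1 / real k) * m_order k q)"

end

theory Submission
  imports Defs
begin

text \<open>
  The proof compares \<open>m\<^sub>k(q)\<close> with \<open>m\<^sub>k(q\<^sub>\<sigma>)\<close> and computes the latter exactly.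

  The two Nikolskii inequalities turn a Markov inequality of order \<open>\<alpha>\<close> for one norm into one for the
  other, at the price of the factor \<open>(deg P)\<^sup>a\<^sup>+\<^sup>b\<close>. Hence \<open>\<bar>m\<^sub>k(q) - m\<^sub>k(q\<^sub>\<sigma>)\<bar> \<le> a + b\<close> for every \<open>k\<close>
  (\<open>m_order_transfer\<close>), and this bounded error disappears after division by \<open>k\<close>. It remains to see
  that \<open>m\<^sub>k(q\<^sub>\<sigma>) = k m(q\<^sub>\<sigma>)\<close>.

  The inequality \<open>m\<^sub>k(p) \<le> k m(p)\<close> holds for every norm \<open>p\<close>: apply a first order Markov inequality
  \<open>k\<close> times, noting that differentiation does not raise the degree
  (\<open>m_order_le_mult_markov_exponent\<close>). Used for \<open>q\<close> itself, it also gives \<open>m(q\<^sub>\<sigma>) \<le> m(q)\<close> in the limit.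

  The reverse inequality is where the spectral property enters. A power of a first derivative can
  be recovered from derivatives of order \<open>k\<close> of powers:
  \<open>k! (\<partial>\<^sub>i P)\<^sup>k = \<Sum>\<^sub>j (-1)\<^sup>k\<^sup>-\<^sup>j (k choose j) P\<^sup>k\<^sup>-\<^sup>j \<partial>\<^sub>i\<^sup>k (P\<^sup>j)\<close>, summed over \<open>j \<le> k\<close>,
  which says that the \<open>k\<close>-fold commutator of \<open>\<partial>\<^sub>i\<^sup>k\<close> with multiplication by \<open>P\<close>, applied to \<open>1\<close>, is
  \<open>k! (\<partial>\<^sub>i P)\<^sup>k\<close> (\<open>iter_comm_funpow\<close>). A spectral norm is submultiplicative up to a factor \<open>2\<close>
  (\<open>spectral_norm_mult_le\<close>), so a Markov inequality for \<open>\<partial>\<^sub>i\<^sup>k\<close> with exponent \<open>s\<close>, applied to the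
  polynomials \<open>P\<^sup>j\<close> of degree at most \<open>k deg P\<close>, bounds \<open>p((\<partial>\<^sub>i P)\<^sup>k) = p(\<partial>\<^sub>i P)\<^sup>k\<close> by a constant times
  \<open>(deg P)\<^sup>s p(P)\<^sup>k\<close>. Taking \<open>k\<close>-th roots yields a first order Markov inequality with exponent \<open>s/k\<close>
  (\<open>spectral_markov_bound_root\<close>).
\<close>

section \<open>Partial derivatives as derivations\<close>

lemma partial_add: "partial i (P + Q) = partial i P + partial i Q"
  by (rule poly_mapping_eqI) (simp add: lookup_partial lookup_add algebra_simps)

lemma partial_0 [simp]: "partial i 0 = 0"
  by (simp add: partial_def)

lemma partial_single:
  "partial i (Poly_Mapping.single m c) =
     Poly_Mapping.single (m - Poly_Mapping.single i 1) (of_nat (Poly_Mapping.lookup m i) * c)"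
  by (cases "c = 0") (simp_all add: partial_def)

lemma poly_mapping_add_induct [case_names zero single add]:
  assumes "Q 0" "\<And>m c. Q (Poly_Mapping.single m c)" "\<And>f g. Q f \<Longrightarrow> Q g \<Longrightarrow> Q (f + g)"
  shows "Q (P :: 'a \<Rightarrow>\<^sub>0 'b::comm_monoid_add)"
proof (induction P rule: update_induct)
  case const
  show ?case by (rule assms(1))
next
  case (update f a b)
  have "Poly_Mapping.update a b f = f + Poly_Mapping.single a b"
    using update(1) by (intro poly_mapping_eqI)
      (auto simp: lookup_update lookup_add lookup_single in_keys_iff when_def)
  then show ?case using assms update by simp
qed

lemma partial_mult_single:
  "partial i (Poly_Mapping.single m a * Poly_Mapping.single l b) =
     partial i (Poly_Mapping.single m a) * Poly_Mapping.single l b +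
     Poly_Mapping.single m a * partial i (Poly_Mapping.single l b)"
proof -
  let ?e = "Poly_Mapping.single i (1::nat)"
  \<comment> \<open>Subtraction of multi-indices truncates; when the exponent \<open>m\<^sub>i\<close> is \<open>0\<close> the coefficient
     vanishes instead.\<close>
  have 1: "m - ?e + l = m + l - ?e" if "Poly_Mapping.lookup m i \<noteq> 0" for m l
    using that by (intro poly_mapping_eqI) (auto simp: lookup_add lookup_minus lookup_single when_def)
  have L: "Poly_Mapping.single (m - ?e + l) (of_nat (Poly_Mapping.lookup m i) * a * b) =
      Poly_Mapping.single (m + l - ?e) (of_nat (Poly_Mapping.lookup m i) * a * b)"
    by (cases "Poly_Mapping.lookup m i = 0") (simp_all only: 1 not_False_eq_True, simp)
  have R: "Poly_Mapping.single (m + (l - ?e)) (a * (of_nat (Poly_Mapping.lookup l i) * b)) =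
      Poly_Mapping.single (m + l - ?e) (a * (of_nat (Poly_Mapping.lookup l i) * b))"
    using 1[of l m]
    by (cases "Poly_Mapping.lookup l i = 0") (simp, simp only: add.commute not_False_eq_True simp_thms)
  show ?thesis
    by (simp only: partial_single mult_single L R single_add[symmetric] lookup_add)
       (simp add: algebra_simps)
qed

lemma partial_mult: "partial i (P * Q) = partial i P * Q + P * partial i Q"
proof (induction P rule: poly_mapping_add_induct)
  case (single m a)
  show ?case
  proof (induction Q rule: poly_mapping_add_induct)
    case (single l b)
    show ?case by (rule partial_mult_single)
  qed (simp_all add: partial_add algebra_simps)
qed (simp_all add: partial_add algebra_simps)

lemma mderiv_single: "mderiv (Poly_Mapping.single i k) P = (partial i ^^ k) P"
proof -
  interpret comp_fun_commute "\<lambda>j. partial j ^^ Poly_Mapping.lookup (Poly_Mapping.single i k) j"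
    by (rule comp_fun_commute_partial)
  have *: "Finite_Set.fold (\<lambda>j. partial j ^^ Poly_Mapping.lookup (Poly_Mapping.single i k) j) P A = P"
    if "finite A" "i \<notin> A" for A
    using that
  proof induction
    case (insert j A)
    then have "Poly_Mapping.lookup (Poly_Mapping.single i k) j = 0"
      by (auto simp: lookup_single)
    with insert show ?case by simp
  qed simp
  have "UNIV = insert i (UNIV - {i})" by auto
  then have "mderiv (Poly_Mapping.single i k) P =
      Finite_Set.fold (\<lambda>j. partial j ^^ Poly_Mapping.lookup (Poly_Mapping.single i k) j) P
        (insert i (UNIV - {i}))"
    unfolding mderiv_def by simp
  also have "\<dots> = (partial i ^^ k) P"
    by (subst fold_insert) (simp_all add: *)
  finally show ?thesis .
qed

lemma mlen_single [simp]: "mlen (Poly_Mapping.single i k) = k"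
  by (simp add: mlen_def lookup_single when_def)

lemma mlen_eq_1D:
  assumes "mlen \<alpha> = 1"
  shows "\<exists>i. \<alpha> = Poly_Mapping.single i 1"
proof -
  obtain i where i: "Poly_Mapping.lookup \<alpha> i \<noteq> 0"
    using assms unfolding mlen_def by (metis sum.neutral zero_neq_one)
  have "(\<Sum>j\<in>UNIV. Poly_Mapping.lookup \<alpha> j) =
      Poly_Mapping.lookup \<alpha> i + (\<Sum>j\<in>UNIV - {i}. Poly_Mapping.lookup \<alpha> j)"
    by (simp add: sum.remove)
  then have "Poly_Mapping.lookup \<alpha> i + (\<Sum>j\<in>UNIV - {i}. Poly_Mapping.lookup \<alpha> j) = 1"
    using assms by (simp add: mlen_def)
  with i have "Poly_Mapping.lookup \<alpha> i = 1" "(\<Sum>j\<in>UNIV - {i}. Poly_Mapping.lookup \<alpha> j) = 0"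
    by linarith+
  then have "\<alpha> = Poly_Mapping.single i 1"
    by (intro poly_mapping_eqI) (auto simp: lookup_single when_def)
  then show ?thesis ..
qed

section \<open>Total degree\<close>

lemma tdeg_leI: "(\<And>m. m \<in> Poly_Mapping.keys P \<Longrightarrow> mlen m \<le> d) \<Longrightarrow> tdeg P \<le> d"
  by (auto simp: tdeg_def)

lemma mlen_le_tdeg: "m \<in> Poly_Mapping.keys P \<Longrightarrow> mlen m \<le> tdeg P"
  by (auto simp: tdeg_def)

lemma mlen_add: "mlen (a + b) = mlen a + mlen b"
  by (simp add: mlen_def lookup_add sum.distrib)

lemma tdeg_mult_le: "tdeg (P * Q) \<le> tdeg P + tdeg Q"
proof (rule tdeg_leI)
  fix m assume "m \<in> Poly_Mapping.keys (P * Q)"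
  then obtain a b where "m = a + b" "a \<in> Poly_Mapping.keys P" "b \<in> Poly_Mapping.keys Q"
    using keys_mult by blast
  then show "mlen m \<le> tdeg P + tdeg Q"
    by (simp add: mlen_add add_mono mlen_le_tdeg)
qed

lemma tdeg_1 [simp]: "tdeg (1 :: 'n::finite cpoly) = 0"
  by (simp add: tdeg_def mlen_def)

lemma tdeg_power_le: "tdeg (P ^ j) \<le> j * tdeg P"
  by (induction j) (simp_all add: order_trans[OF tdeg_mult_le])

lemma tdeg_partial_le: "tdeg (partial i P) \<le> tdeg P"
proof (rule tdeg_leI)
  fix m assume "m \<in> Poly_Mapping.keys (partial i P)"
  then have "m + Poly_Mapping.single i 1 \<in> Poly_Mapping.keys P"
    by (simp add: in_keys_iff lookup_partial)
  from mlen_le_tdeg[OF this] show "mlen m \<le> tdeg P"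
    by (simp add: mlen_add)
qed

lemma tdeg_funpow_partial_le: "tdeg ((partial i ^^ n) P) \<le> tdeg P"
  by (induction n) (auto intro: order_trans[OF tdeg_partial_le])

lemma tdeg_fold_partial_le:
  assumes "finite A"
  shows "tdeg (Finite_Set.fold (\<lambda>i. partial i ^^ f i) P A) \<le> tdeg P"
proof -
  interpret comp_fun_commute "\<lambda>i. partial i ^^ f i" by (rule comp_fun_commute_partial)
  show ?thesis using assms
    by induction (auto intro: order_trans[OF tdeg_funpow_partial_le])
qed

lemma tdeg_mderiv_le: "tdeg (mderiv \<alpha> P) \<le> tdeg P"
  unfolding mderiv_def by (rule tdeg_fold_partial_le) simp

section \<open>The power of a derivative as an iterated commutator\<close>

text \<open>
  The iterated commutator \<open>[\<dots>[[T, P], P], \<dots>, P]\<close> of the operator \<open>T\<close> with multiplication by \<open>P\<close>,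
  evaluated at \<open>F\<close>. The recursive form avoids alternating binomial sums.
\<close>

primrec iter_comm :: "'a::comm_ring_1 \<Rightarrow> nat \<Rightarrow> ('a \<Rightarrow> 'a) \<Rightarrow> 'a \<Rightarrow> 'a" where
  "iter_comm P 0 T F = T F"
| "iter_comm P (Suc k) T F = iter_comm P k T (P * F) - P * iter_comm P k T F"

lemma iter_comm_add:
  assumes "\<And>F G. T (F + G) = T F + T G"
  shows "iter_comm P k T (F + G) = iter_comm P k T F + iter_comm P k T G"
  by (induction k arbitrary: F G) (simp_all add: assms algebra_simps)

text \<open>
  Moving \<open>D\<close> through one commutator with \<open>P\<close> leaves the multiplication operator by \<open>D P\<close>, since
  \<open>D (P F) - P (D F) = D P F\<close>. This operator commutes with \<open>P\<close>, so each of the \<open>k + 1\<close> commutators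
  contributes the same extra term.
\<close>

lemma iter_comm_derivation:
  assumes "\<And>F G. T (F + G) = T F + T G"
    and D: "\<And>F G. D (F * G) = D F * G + F * D G"
  shows "iter_comm P (Suc k) (T \<circ> D) F =
    iter_comm P (Suc k) T (D F) + of_nat (Suc k) * iter_comm P k T (D P * F)"
proof (induction k arbitrary: F)
  case 0
  show ?case by (simp add: D assms(1))
next
  case (Suc k)
  have "iter_comm P (Suc (Suc k)) (T \<circ> D) F =
      iter_comm P (Suc k) T (D (P * F)) + of_nat (Suc k) * iter_comm P k T (D P * (P * F))
      - P * (iter_comm P (Suc k) T (D F) + of_nat (Suc k) * iter_comm P k T (D P * F))"
    by (subst iter_comm.simps(2), subst (1 2) Suc.IH) (rule refl)
  also have "iter_comm P (Suc k) T (D (P * F)) =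
      iter_comm P (Suc k) T (D P * F) + iter_comm P (Suc k) T (P * D F)"
    by (simp only: D iter_comm_add[of T, OF assms(1)])
  also have "D P * (P * F) = P * (D P * F)" by (simp add: mult.left_commute)
  finally show ?case by (simp add: algebra_simps)
qed

text \<open>
  Each commutator with a multiplication operator lowers the order of the differential operator
  \<open>D\<^sup>n\<close> by one. After \<open>n\<close> of them only multiplication by the principal symbol \<open>n! (D P)\<^sup>n\<close> is left,
  and one more gives zero. The vanishing part feeds the induction for the principal symbol.
\<close>

lemma iter_comm_funpow:
  assumes add: "\<And>F G. D (F + G) = D F + D G"
    and D: "\<And>F G. D (F * G) = D F * G + F * D G"
  shows "(n < k \<longrightarrow> iter_comm P k (D ^^ n) F = 0) \<and>
    iter_comm P n (D ^^ n) F = of_nat (fact n) * D P ^ n * F"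
proof (induction n arbitrary: k F)
  case 0
  have "iter_comm P (Suc k) (D ^^ 0) F = 0" for k F
  proof (induction k arbitrary: F)
    case (Suc k)
    show ?case by (subst iter_comm.simps(2), subst (1 2) Suc.IH) simp
  qed simp
  then have "0 < k \<longrightarrow> iter_comm P k (D ^^ 0) F = 0"
    using gr0_conv_Suc by metis
  then show ?case by (simp add: id_def)
next
  case (Suc n)
  have add_n: "(D ^^ n) (F + G) = (D ^^ n) F + (D ^^ n) G" for F G
    by (induction n) (simp_all add: add)
  have step: "iter_comm P (Suc k) (D ^^ Suc n) F =
      iter_comm P (Suc k) (D ^^ n) (D F) + of_nat (Suc k) * iter_comm P k (D ^^ n) (D P * F)" for k
    unfolding funpow_Suc_right by (rule iter_comm_derivation[OF add_n D])
  have "iter_comm P k (D ^^ Suc n) F = 0" if k: "Suc n < k"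
  proof -
    obtain l where "k = Suc l" "n < l" using k by (cases k) auto
    then show ?thesis using Suc.IH by (simp only: step) simp
  qed
  moreover have "iter_comm P (Suc n) (D ^^ Suc n) F = of_nat (fact (Suc n)) * D P ^ Suc n * F"
    using Suc.IH by (simp only: step) (simp add: algebra_simps)
  ultimately show ?case by blast
qed

section \<open>Norms on polynomials\<close>

lemma poly_norm_nonneg: "poly_norm p \<Longrightarrow> 0 \<le> p P"
  and poly_norm_eq_0_iff: "poly_norm p \<Longrightarrow> p P = 0 \<longleftrightarrow> P = 0"
  and poly_norm_triangle: "poly_norm p \<Longrightarrow> p (P + Q) \<le> p P + p Q"
  and poly_norm_scale: "poly_norm p \<Longrightarrow> p (Poly_Mapping.single 0 c * P) = cmod c * p P"
  by (simp_all add: poly_norm_def mult_map_scale_conv_mult)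

lemma poly_norm_minus: "poly_norm p \<Longrightarrow> p (- P) = p P"
  using poly_norm_scale[of p "-1" P] by (simp add: single_uminus)

lemma poly_norm_triangle_diff: "poly_norm p \<Longrightarrow> p (P - Q) \<le> p P + p Q"
  using poly_norm_triangle[of p P "- Q"] by (simp add: poly_norm_minus)

lemma poly_norm_of_nat: "poly_norm p \<Longrightarrow> p (of_nat n * P) = real n * p P"
  using poly_norm_scale[of p "of_nat n" P] by simp

lemma spectral_norm_poly_norm: "spectral_norm p \<Longrightarrow> poly_norm p"
  and spectral_norm_power: "spectral_norm p \<Longrightarrow> n \<ge> 1 \<Longrightarrow> p (P ^ n) = p P ^ n"
  by (simp_all add: spectral_norm_def)

text \<open>
  The polarisation identity \<open>4 u v = (u + v)\<^sup>2 - (u - v)\<^sup>2\<close> reduces products to squares, whose norm is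
  known exactly. The triangle inequality loses least when \<open>u\<close> and \<open>v\<close> have equal norms, so \<open>P\<close> and \<open>Q\<close>
  are first rescaled by each other's norm.
\<close>

lemma spectral_norm_mult_le:
  assumes "spectral_norm p"
  shows "p (P * Q) \<le> 2 * p P * p Q"
proof (cases "p P = 0 \<or> p Q = 0")
  case True
  have pn: "poly_norm p" using assms by (rule spectral_norm_poly_norm)
  from True have "P * Q = 0" by (auto simp: poly_norm_eq_0_iff[OF pn])
  moreover from this have "p (P * Q) = 0" by (simp add: poly_norm_eq_0_iff[OF pn])
  ultimately show ?thesis using True by auto
next
  case False
  have pn: "poly_norm p" using assms by (rule spectral_norm_poly_norm)
  define x y where "x = p P" and "y = p Q"
  have pos: "x > 0" "y > 0"
    using False poly_norm_nonneg[OF pn] by (simp_all add: x_def y_def order_less_le)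
  define u v where "u = Poly_Mapping.single 0 (complex_of_real y) * P"
    and "v = Poly_Mapping.single 0 (complex_of_real x) * Q"
  have uv: "p u = x * y" "p v = x * y"
    using pos by (simp_all add: u_def v_def poly_norm_scale[OF pn] x_def y_def)
  have "Poly_Mapping.single 0 (complex_of_real (4 * x * y)) * (P * Q) = of_nat 4 * (u * v)"
  proof -
    have "Poly_Mapping.single 0 (complex_of_real (4 * x * y)) =
        of_nat 4 * (Poly_Mapping.single 0 (complex_of_real y) * Poly_Mapping.single (0::'a \<Rightarrow>\<^sub>0 nat) (complex_of_real x))"
      unfolding single_of_nat[symmetric] mult_single by (simp add: mult_ac)
    then show ?thesis by (simp add: u_def v_def mult_ac)
  qed
  also have "\<dots> = (u + v) ^ 2 - (u - v) ^ 2"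
    by (simp add: power2_eq_square algebra_simps)
  finally have "p (Poly_Mapping.single 0 (complex_of_real (4 * x * y)) * (P * Q)) \<le>
      p (u + v) ^ 2 + p (u - v) ^ 2"
    using poly_norm_triangle_diff[OF pn, of "(u + v)\<^sup>2" "(u - v)\<^sup>2"]
    by (simp add: spectral_norm_power[OF assms])
  also have "\<dots> \<le> (2 * (x * y)) ^ 2 + (2 * (x * y)) ^ 2"
    using poly_norm_triangle[OF pn, of u v] poly_norm_triangle_diff[OF pn, of u v] poly_norm_nonneg[OF pn]
    by (intro add_mono power_mono) (simp_all add: uv)
  finally have "(4 * x * y) * p (P * Q) \<le> (2 * (x * y)) ^ 2 + (2 * (x * y)) ^ 2"
    unfolding poly_norm_scale[OF pn] norm_of_real using pos by simp
  then have "(4 * x * y) * p (P * Q) \<le> (4 * x * y) * (2 * x * y)"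
    by (simp add: power2_eq_square mult_ac)
  then show ?thesis using pos by (simp add: x_def y_def)
qed

section \<open>Markov inequalities and Markov exponents\<close>

definition markov_bound :: "('n::finite \<Rightarrow>\<^sub>0 nat) \<Rightarrow> real \<Rightarrow> ('n cpoly \<Rightarrow> real) \<Rightarrow> bool" where
  "markov_bound \<alpha> s p \<longleftrightarrow> (\<exists>M>0. \<forall>P. p (mderiv \<alpha> P) \<le> M * real (tdeg P) powr s * p P)"

lemma m_alpha_le: "s > 0 \<Longrightarrow> markov_bound \<alpha> s p \<Longrightarrow> m_alpha \<alpha> p \<le> ereal s"
  unfolding m_alpha_def markov_bound_def by (intro Inf_lower) auto

lemma m_alpha_greatest:
  "(\<And>s. s > 0 \<Longrightarrow> markov_bound \<alpha> s p \<Longrightarrow> x \<le> ereal s) \<Longrightarrow> x \<le> m_alpha \<alpha> p"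
  unfolding m_alpha_def markov_bound_def by (intro Inf_greatest) auto

lemma m_alpha_nonneg: "0 \<le> m_alpha \<alpha> p"
  by (rule m_alpha_greatest) simp

lemma real_powr_mono_exponent: "s \<le> t \<Longrightarrow> real n powr s \<le> real n powr t"
  by (cases "n = 0") (auto intro: powr_mono)

lemma m_alpha_lessD:
  assumes "poly_norm p" "m_alpha \<alpha> p < ereal s"
  shows "markov_bound \<alpha> s p"
proof -
  obtain t M where "t < s" and M: "M > 0" "\<And>P. p (mderiv \<alpha> P) \<le> M * real (tdeg P) powr t * p P"
    using assms(2) unfolding m_alpha_def Inf_less_iff by auto
  have "p (mderiv \<alpha> P) \<le> M * real (tdeg P) powr s * p P" for P
    using M \<open>t < s\<close> poly_norm_nonneg[OF assms(1)]
    by (intro order_trans[OF M(2)] mult_mono real_powr_mono_exponent) auto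
  with M(1) show ?thesis unfolding markov_bound_def by blast
qed

lemma m_alpha_le_m_order: "m_alpha \<alpha> p \<le> m_order (mlen \<alpha>) p"
  unfolding m_order_def by (intro Max_ge finite_imageI finite_mlen_eq) auto

lemma m_order_leI: "(\<And>\<alpha>. mlen \<alpha> = k \<Longrightarrow> m_alpha \<alpha> p \<le> x) \<Longrightarrow> m_order k p \<le> x"
  unfolding m_order_def using mlen_eq_nonempty[of k]
  by (subst Max_le_iff) (auto simp: finite_mlen_eq)

lemma m_order_nonneg: "0 \<le> m_order k p"
  using m_alpha_nonneg m_alpha_le_m_order[of "Poly_Mapping.single undefined k" p] order_trans
  by fastforce

section \<open>Comparable norms\<close>

text \<open>
  The chain is \<open>p(D\<^sup>\<alpha>P) \<lesssim> d\<^sup>b r(D\<^sup>\<alpha>P) \<lesssim> d\<^sup>b\<^sup>+\<^sup>s r(P) \<lesssim> d\<^sup>a\<^sup>+\<^sup>b\<^sup>+\<^sup>s p(P)\<close> with \<open>d = deg P\<close>. Its first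
  step must also cover the case that \<open>D\<^sup>\<alpha>P\<close> is constant, where the comparison hypotheses are silent.
  On constants the two norms are proportional, and the constant \<open>C\<close> absorbs the ratio. For constant
  \<open>P\<close> the hypothesis itself forces \<open>D\<^sup>\<alpha>P = 0\<close>.
\<close>

lemma markov_bound_transfer:
  assumes p: "poly_norm p" and r: "poly_norm r"
    and c: "0 \<le> a" "0 \<le> b" "0 < A" "0 < B"
    and rp: "\<And>P. tdeg P \<ge> 1 \<Longrightarrow> r P \<le> A * real (tdeg P) powr a * p P"
    and pr: "\<And>P. tdeg P \<ge> 1 \<Longrightarrow> p P \<le> B * real (tdeg P) powr b * r P"
    and m: "markov_bound \<alpha> s r"
  shows "markov_bound \<alpha> (s + (a + b)) p"
proof -
  obtain M where M: "M > 0" "\<And>P. r (mderiv \<alpha> P) \<le> M * real (tdeg P) powr s * r P"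
    using m unfolding markov_bound_def by blast
  define C where "C = B + p 1 / r 1"
  have r1: "r 1 > 0"
    using poly_norm_nonneg[OF r, of 1] poly_norm_eq_0_iff[OF r, of 1] by (simp add: order_less_le)
  have BC: "B \<le> C" "0 < C" "p 1 / r 1 \<le> C"
    using c r1 poly_norm_nonneg[OF p, of 1] by (simp_all add: C_def add_pos_nonneg)
  have pr': "p Q \<le> C * real d powr b * r Q" if "tdeg Q \<le> d" "1 \<le> d" for Q d
  proof (cases "tdeg Q = 0")
    case False
    then have "p Q \<le> B * real (tdeg Q) powr b * r Q" by (intro pr) simp
    also have "\<dots> \<le> C * real d powr b * r Q"
      using that c BC poly_norm_nonneg[OF r] by (intro mult_mono powr_mono2) auto
    finally show ?thesis .
  next
    case True
    have *: "m = 0" if "m \<in> Poly_Mapping.keys Q" for m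
      using mlen_le_tdeg[OF that] True by (intro poly_mapping_eqI) (simp add: mlen_def)
    have "Q = Poly_Mapping.single 0 (Poly_Mapping.lookup Q 0) * 1"
      using * by (intro poly_mapping_eqI) (auto simp: lookup_single when_def in_keys_iff)
    then have Q: "p Q = cmod (Poly_Mapping.lookup Q 0) * p 1" "r Q = cmod (Poly_Mapping.lookup Q 0) * r 1"
      using poly_norm_scale[OF p] poly_norm_scale[OF r] by metis+
    have "p Q = (p 1 / r 1) * 1 * r Q" using r1 by (simp add: Q)
    also have "\<dots> \<le> C * real d powr b * r Q"
      using that c BC poly_norm_nonneg[OF r] by (intro mult_mono ge_one_powr_ge_zero) auto
    finally show ?thesis .
  qed
  have "p (mderiv \<alpha> P) \<le> C * M * A * real (tdeg P) powr (s + (a + b)) * p P" for P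
  proof (cases "tdeg P = 0")
    case True
    then have "r (mderiv \<alpha> P) = 0"
      using M(2)[of P] poly_norm_nonneg[OF r, of "mderiv \<alpha> P"] by simp
    then have "p (mderiv \<alpha> P) = 0" by (simp add: poly_norm_eq_0_iff[OF r] poly_norm_eq_0_iff[OF p])
    then show ?thesis by (simp add: True)
  next
    case False
    let ?d = "real (tdeg P)"
    have "p (mderiv \<alpha> P) \<le> C * ?d powr b * r (mderiv \<alpha> P)"
      using False by (intro pr' tdeg_mderiv_le) simp
    also have "\<dots> \<le> C * ?d powr b * (M * ?d powr s * (A * ?d powr a * p P))"
      using False M(1) BC by (intro mult_left_mono order_trans[OF M(2)] rp) auto
    also have "\<dots> = C * M * A * ?d powr (s + (a + b)) * p P"
      by (simp add: powr_add mult_ac)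
    finally show ?thesis .
  qed
  moreover have "C * M * A > 0" using BC M(1) c by simp
  ultimately show ?thesis unfolding markov_bound_def by blast
qed

lemma m_order_transfer:
  assumes "poly_norm p" "poly_norm r"
    and "0 \<le> a" "0 \<le> b" "0 < A" "0 < B"
    and "\<And>P. tdeg P \<ge> 1 \<Longrightarrow> r P \<le> A * real (tdeg P) powr a * p P"
    and "\<And>P. tdeg P \<ge> 1 \<Longrightarrow> p P \<le> B * real (tdeg P) powr b * r P"
  shows "m_order k p \<le> m_order k r + ereal (a + b)"
proof (rule m_order_leI)
  fix \<alpha> :: "'a \<Rightarrow>\<^sub>0 nat" assume "mlen \<alpha> = k"
  have "m_alpha \<alpha> p - ereal (a + b) \<le> m_alpha \<alpha> r"
  proof (rule m_alpha_greatest)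
    fix s assume "s > 0" "markov_bound \<alpha> s r"
    then have "m_alpha \<alpha> p \<le> ereal (s + (a + b))"
      using assms by (intro m_alpha_le markov_bound_transfer[of p r a b A B]) auto
    then show "m_alpha \<alpha> p - ereal (a + b) \<le> ereal s"
      by (simp add: ereal_minus_le)
  qed
  then have "m_alpha \<alpha> p \<le> m_alpha \<alpha> r + ereal (a + b)"
    by (simp add: ereal_minus_le)
  also have "\<dots> \<le> m_order k r + ereal (a + b)"
    using m_alpha_le_m_order[of \<alpha> r] \<open>mlen \<alpha> = k\<close> by (simp add: add_right_mono)
  finally show "m_alpha \<alpha> p \<le> m_order k r + ereal (a + b)" .
qed

section \<open>Iterating first order Markov inequalities\<close>

text \<open>
  Differentiating does not raise the degree, so each of the \<open>|\<alpha>|\<close> single steps costs at most a factor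
  \<open>M\<^sub>i (deg P)\<^sup>s\<close>.
\<close>

lemma markov_bound_iterate:
  assumes p: "poly_norm p" and "s > 0" "mlen \<alpha> \<ge> 1"
    and first: "\<And>i. markov_bound (Poly_Mapping.single i 1) s p"
  shows "markov_bound \<alpha> (real (mlen \<alpha>) * s) p"
proof -
  have "\<forall>i. \<exists>M>0. \<forall>P. p (partial i P) \<le> M * real (tdeg P) powr s * p P"
    using first unfolding markov_bound_def mderiv_single by simp
  then obtain M where M: "\<And>i. M i > 0"
      "\<And>i P. p (partial i P) \<le> M i * real (tdeg P) powr s * p P"
    by metis
  \<comment> \<open>The factor is kept as a natural power of \<open>(deg P)\<^sup>s\<close>: an empty product must be \<open>1\<close> even when
     \<open>deg P = 0\<close>, whereas \<open>0 powr 0 = 0\<close>.\<close>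
  define x where "x P = real (tdeg P) powr s" for P :: "'a cpoly"
  have pow: "p ((partial i ^^ n) P) \<le> (M i * x P) ^ n * p P" for i n P
  proof (induction n)
    case (Suc n)
    have "p ((partial i ^^ Suc n) P) \<le> M i * x ((partial i ^^ n) P) * p ((partial i ^^ n) P)"
      by (simp add: x_def M(2))
    also have "\<dots> \<le> M i * x P * ((M i * x P) ^ n * p P)"
    proof (rule mult_mono[OF _ Suc.IH])
      have "x ((partial i ^^ n) P) \<le> x P"
        unfolding x_def using \<open>s > 0\<close> tdeg_funpow_partial_le[of n i P] by (intro powr_mono2) auto
      then show "M i * x ((partial i ^^ n) P) \<le> M i * x P"
        using M(1)[of i] by simp
    qed (use M(1)[of i] poly_norm_nonneg[OF p] in \<open>auto simp: x_def\<close>)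
    finally show ?case by (simp add: mult_ac)
  qed simp
  interpret comp_fun_commute "\<lambda>i. partial i ^^ Poly_Mapping.lookup \<alpha> i"
    by (rule comp_fun_commute_partial)
  have fold: "p (Finite_Set.fold (\<lambda>i. partial i ^^ Poly_Mapping.lookup \<alpha> i) P S) \<le>
      (\<Prod>i\<in>S. (M i * x P) ^ Poly_Mapping.lookup \<alpha> i) * p P" if "finite S" for P S
    using that
  proof induction
    case (insert i S)
    let ?Q = "Finite_Set.fold (\<lambda>i. partial i ^^ Poly_Mapping.lookup \<alpha> i) P S"
    have "p ((partial i ^^ Poly_Mapping.lookup \<alpha> i) ?Q) \<le>
        (M i * x ?Q) ^ Poly_Mapping.lookup \<alpha> i * p ?Q"
      by (rule pow)
    also have "\<dots> \<le> (M i * x P) ^ Poly_Mapping.lookup \<alpha> i *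
        ((\<Prod>i\<in>S. (M i * x P) ^ Poly_Mapping.lookup \<alpha> i) * p P)"
    proof (rule mult_mono[OF _ insert.IH])
      have "x ?Q \<le> x P" unfolding x_def
        using tdeg_fold_partial_le[OF insert.hyps(1), of "Poly_Mapping.lookup \<alpha>" P] \<open>s > 0\<close>
        by (intro powr_mono2) auto
      then show "(M i * x ?Q) ^ Poly_Mapping.lookup \<alpha> i \<le> (M i * x P) ^ Poly_Mapping.lookup \<alpha> i"
        using M(1)[of i] by (intro power_mono mult_left_mono) (auto simp: x_def)
    qed (use M(1)[of i] poly_norm_nonneg[OF p] in \<open>auto simp: x_def\<close>)
    finally show ?case
      using insert.hyps(1,2)
      by (simp only: fold_insert prod.insert mult.assoc not_False_eq_True)
  qed simp
  define C where "C = (\<Prod>i\<in>UNIV. M i ^ Poly_Mapping.lookup \<alpha> i)"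
  have "C > 0" unfolding C_def using M(1) by (intro prod_pos) auto
  moreover have "p (mderiv \<alpha> P) \<le> C * real (tdeg P) powr (real (mlen \<alpha>) * s) * p P" for P
  proof -
    have "p (mderiv \<alpha> P) \<le> (\<Prod>i\<in>UNIV. (M i * x P) ^ Poly_Mapping.lookup \<alpha> i) * p P"
      unfolding mderiv_def by (rule fold) simp
    also have "(\<Prod>i\<in>UNIV. (M i * x P) ^ Poly_Mapping.lookup \<alpha> i) = C * x P ^ mlen \<alpha>"
      by (simp add: C_def power_mult_distrib prod.distrib mlen_def power_sum)
    also have "x P ^ mlen \<alpha> = real (tdeg P) powr (real (mlen \<alpha>) * s)"
      using \<open>mlen \<alpha> \<ge> 1\<close> by (cases "tdeg P = 0") (simp_all add: x_def powr_power)
    finally show ?thesis .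
  qed
  ultimately show ?thesis unfolding markov_bound_def by blast
qed

lemma m_order_le_mult_markov_exponent:
  assumes p: "poly_norm p" and k: "k \<ge> 1"
  shows "m_order k p \<le> ereal (real k) * markov_exponent p"
proof (cases "markov_exponent p")
  case PInf
  then show ?thesis using k by simp
next
  case MInf
  then show ?thesis using m_order_nonneg[of 1 p] by (simp add: markov_exponent_def)
next
  case (real r)
  have "r \<ge> 0" using m_order_nonneg[of 1 p] real by (simp add: markov_exponent_def)
  show ?thesis
  proof (rule m_order_leI)
    fix \<alpha> :: "'a \<Rightarrow>\<^sub>0 nat" assume \<alpha>: "mlen \<alpha> = k"
    have "m_alpha \<alpha> p \<le> ereal (real k * r) + ereal e" if "e > 0" for e
    proof -
      \<comment> \<open>The infimum \<open>r\<close> need not be attained, so the iteration starts slightly above it.\<close>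
      define s where "s = r + e / real k"
      have s: "s > r" using that k by (simp add: s_def)
      have "m_alpha (Poly_Mapping.single i 1) p < ereal s" for i
        using m_alpha_le_m_order[of "Poly_Mapping.single i 1" p] real s
        by (simp add: markov_exponent_def order_le_less_trans)
      then have "markov_bound (Poly_Mapping.single i 1) s p" for i
        by (rule m_alpha_lessD[OF p])
      then have "markov_bound \<alpha> (real k * s) p"
        using markov_bound_iterate[OF p, of s \<alpha>] s \<open>r \<ge> 0\<close> k \<alpha> by simp
      then have "m_alpha \<alpha> p \<le> ereal (real k * s)"
        using s \<open>r \<ge> 0\<close> k by (intro m_alpha_le) auto
      then show ?thesis using k by (simp add: s_def algebra_simps)
    qed
    then have "m_alpha \<alpha> p \<le> ereal (real k * r)"
      by (rule ereal_le_epsilon2)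
    then show "m_alpha \<alpha> p \<le> ereal (real k) * markov_exponent p"
      by (simp add: real)
  qed
qed

section \<open>Spectral norms\<close>

text \<open>
  Every commutator is a difference of two terms. The first raises the power of \<open>P\<close> inside \<open>T\<close>, the
  second costs the factor \<open>2\<close> of \<open>spectral_norm_mult_le\<close>, which adds up to \<open>1 + 2 = 3\<close> per commutator.
\<close>

lemma spectral_iter_comm_le:
  assumes "spectral_norm p"
    and "\<And>i. i \<le> n \<Longrightarrow> p (T (P ^ i)) \<le> C * p P ^ i"
    and "j + k \<le> n"
  shows "p (iter_comm P k T (P ^ j)) \<le> 3 ^ k * C * p P ^ (j + k)"
  using assms(3)
proof (induction k arbitrary: j)
  case 0
  then show ?case using assms(2)[of j] by simp
next
  case (Suc k)
  have pn: "poly_norm p" using assms(1) by (rule spectral_norm_poly_norm)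
  have "p (iter_comm P (Suc k) T (P ^ j)) \<le>
      p (iter_comm P k T (P ^ Suc j)) + p (P * iter_comm P k T (P ^ j))"
    using poly_norm_triangle_diff[OF pn] by simp
  also have "\<dots> \<le> 3 ^ k * C * p P ^ (Suc j + k) + 2 * p P * (3 ^ k * C * p P ^ (j + k))"
    using Suc.prems poly_norm_nonneg[OF pn]
    by (intro add_mono Suc.IH order_trans[OF spectral_norm_mult_le[OF assms(1)]] mult_left_mono) auto
  also have "\<dots> = 3 ^ Suc k * C * p P ^ (j + Suc k)" by simp
  finally show ?case .
qed

text \<open>
  Since \<open>\<partial>\<^sub>i\<^sup>k\<close> is controlled on all powers \<open>P\<^sup>j\<close> with \<open>j \<le> k\<close>, so is its \<open>k\<close>-fold commutator with \<open>P\<close>,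
  which is \<open>k! (\<partial>\<^sub>i P)\<^sup>k\<close>. The spectral property turns this into a bound for \<open>p(\<partial>\<^sub>i P)\<^sup>k\<close>, and the
  \<open>k\<close>-th root divides the exponent by \<open>k\<close>.
\<close>

lemma spectral_markov_bound_root:
  assumes sp: "spectral_norm p" and "s > 0" and k: "k \<ge> 1"
    and m: "markov_bound (Poly_Mapping.single i k) s p"
  shows "markov_bound (Poly_Mapping.single i 1) (s / real k) p"
proof -
  have pn: "poly_norm p" using sp by (rule spectral_norm_poly_norm)
  obtain M where M: "M > 0" "\<And>P. p ((partial i ^^ k) P) \<le> M * real (tdeg P) powr s * p P"
    using m unfolding markov_bound_def mderiv_single by blast
  define R where "R = root k (3 ^ k * M * real k powr s)"
  have R: "R > 0" "R ^ k = 3 ^ k * M * real k powr s"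
    using k M(1) by (simp_all add: R_def real_root_gt_zero)
  have "p (partial i P) \<le> R * real (tdeg P) powr (s / real k) * p P" for P
  proof -
    let ?d = "real (tdeg P)"
    define C where "C = M * (real k * ?d) powr s"
    \<comment> \<open>For \<open>j = 0\<close> the power is the constant \<open>1\<close> of degree \<open>0\<close>, so the Markov inequality
       makes the left-hand side vanish.\<close>
    have C: "p ((partial i ^^ k) (P ^ j)) \<le> C * p P ^ j" if "j \<le> k" for j
    proof (cases "j = 0")
      case True
      have "p ((partial i ^^ k) (P ^ j)) \<le> 0" using M(2)[of 1] True by simp
      also have "0 \<le> C * p P ^ j" using M(1) True by (simp add: C_def)
      finally show ?thesis .
    next
      case False
      have "real (tdeg (P ^ j)) \<le> real (k * tdeg P)"
        unfolding of_nat_le_iff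
        by (rule order_trans[OF tdeg_power_le mult_le_mono1[OF that]])
      then have "real (tdeg (P ^ j)) powr s \<le> (real k * ?d) powr s"
        using \<open>s > 0\<close> by (intro powr_mono2) auto
      then have "M * real (tdeg (P ^ j)) powr s * p (P ^ j) \<le> C * p (P ^ j)"
        unfolding C_def using M(1) poly_norm_nonneg[OF pn] by (intro mult_right_mono mult_left_mono) auto
      then show ?thesis using M(2)[of "P ^ j"] False spectral_norm_power[OF sp, of j P] by simp
    qed
    have id: "iter_comm P k (partial i ^^ k) 1 = of_nat (fact k) * partial i P ^ k"
      using iter_comm_funpow[of "partial i" k k P 1] by (simp add: partial_add partial_mult)
    have "p (partial i P) ^ k \<le> fact k * p (partial i P) ^ k"
      using mult_right_mono[OF fact_ge_1[of k], of "p (partial i P) ^ k"] poly_norm_nonneg[OF pn] by simp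
    also have "\<dots> = p (iter_comm P k (partial i ^^ k) (P ^ 0))"
      using poly_norm_of_nat[OF pn, of "fact k" "partial i P ^ k"] k
      by (simp only: power_0 id) (simp add: spectral_norm_power[OF sp])
    also have "\<dots> \<le> 3 ^ k * C * p P ^ (0 + k)"
      by (rule spectral_iter_comm_le[where n = k, OF sp]) (rule C, simp_all)
    also have "\<dots> = (R * ?d powr (s / real k) * p P) ^ k"
      using k by (cases "tdeg P = 0") (simp_all add: C_def power_mult_distrib R(2) powr_power powr_mult)
    finally show ?thesis
      using R(1) k poly_norm_nonneg[OF pn] by (subst (asm) power_mono_iff) auto
  qed
  then show ?thesis
    using R(1) unfolding markov_bound_def mderiv_single by auto
qed

lemma spectral_markov_exponent_le:
  assumes sp: "spectral_norm p" and k: "k \<ge> 1"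
  shows "markov_exponent p \<le> ereal (1 / real k) * m_order k p"
  unfolding markov_exponent_def
proof (rule m_order_leI)
  fix \<alpha> :: "'a \<Rightarrow>\<^sub>0 nat" assume "mlen \<alpha> = 1"
  then obtain i where \<alpha>: "\<alpha> = Poly_Mapping.single i 1" using mlen_eq_1D by blast
  have "ereal (real k) * m_alpha \<alpha> p \<le> m_alpha (Poly_Mapping.single i k) p"
  proof (rule m_alpha_greatest)
    fix s assume "s > 0" "markov_bound (Poly_Mapping.single i k) s p"
    then have "m_alpha \<alpha> p \<le> ereal (s / real k)"
      unfolding \<alpha> using k by (intro m_alpha_le spectral_markov_bound_root[OF sp]) auto
    then have "ereal (real k) * m_alpha \<alpha> p \<le> ereal (real k) * ereal (s / real k)"
      by (intro ereal_mult_left_mono) auto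
    then show "ereal (real k) * m_alpha \<alpha> p \<le> ereal s" using k by simp
  qed
  also have "\<dots> \<le> m_order k p" using m_alpha_le_m_order[of "Poly_Mapping.single i k" p] by simp
  finally have "ereal (1 / real k) * (ereal (real k) * m_alpha \<alpha> p) \<le> ereal (1 / real k) * m_order k p"
    by (intro ereal_mult_left_mono) auto
  then show "m_alpha \<alpha> p \<le> ereal (1 / real k) * m_order k p"
    using k by (simp add: mult.assoc[symmetric] one_ereal_def[symmetric])
qed

theorem theorem24:
  fixes q q\<sigma> :: "'n::finite cpoly \<Rightarrow> real"
  assumes "poly_norm q"
    and "spectral_norm q\<sigma>"
    and "spectral_admissible q q\<sigma>"
  shows "(\<lambda>k. ereal (1 / real k) * m_order k q) \<longlonglongrightarrow> markov_exponent q\<sigma>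
    \<and> asymptotic_exponent q = markov_exponent q\<sigma>
    \<and> markov_exponent q\<sigma> \<le> markov_exponent q"
proof -
  let ?f = "\<lambda>k. ereal (1 / real k) * m_order k q"
  let ?m = "markov_exponent q\<sigma>"
  have s: "poly_norm q\<sigma>" using assms(2) by (rule spectral_norm_poly_norm)
  obtain A B a b where c: "A > 0" "B > 0" "a \<ge> 0" "b \<ge> 0"
    and rp: "\<And>P. tdeg P \<ge> 1 \<Longrightarrow> q\<sigma> P \<le> A * real (tdeg P) powr a * q P"
    and pr: "\<And>P. tdeg P \<ge> 1 \<Longrightarrow> q P \<le> B * real (tdeg P) powr b * q\<sigma> P"
    using assms(3) unfolding spectral_admissible_def by blast
  have up: "m_order k q \<le> m_order k q\<sigma> + ereal (a + b)" for k
    by (rule m_order_transfer[OF assms(1) s c(3,4,1,2) rp pr])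
  have lo: "m_order k q\<sigma> \<le> m_order k q + ereal (a + b)" for k
    using m_order_transfer[OF s assms(1) c(4,3,2,1) pr rp, of k] by (simp add: add.commute)
  have upper: "?f k \<le> ereal ((a + b) / real k) + ?m" if k: "k \<ge> 1" for k
  proof -
    have "?f k \<le> ereal (1 / real k) * (ereal (real k) * ?m + ereal (a + b))"
      using up[of k] m_order_le_mult_markov_exponent[OF s k]
      by (intro ereal_mult_left_mono) (auto intro: order_trans add_right_mono)
    also have "\<dots> = ereal ((a + b) / real k) + ?m"
      using k by (cases ?m) (simp_all add: field_simps)
    finally show ?thesis .
  qed
  have lower: "ereal (- ((a + b) / real k)) + ?m \<le> ?f k" if k: "k \<ge> 1" for k
  proof -
    have "?m \<le> ereal (1 / real k) * m_order k q\<sigma>"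
      by (rule spectral_markov_exponent_le[OF assms(2) k])
    also have "\<dots> \<le> ereal (1 / real k) * (m_order k q + ereal (a + b))"
      using lo by (intro ereal_mult_left_mono) auto
    also have "\<dots> = ?f k + ereal ((a + b) / real k)"
      using k by (cases "m_order k q") (simp_all add: field_simps)
    finally show ?thesis by (cases ?m; cases "?f k") auto
  qed
  have "?m \<noteq> -\<infinity>" using m_order_nonneg[of 1 q\<sigma>] by (auto simp: markov_exponent_def)
  then have squeeze: "(\<lambda>k. ereal (c / real k) + ?m) \<longlonglongrightarrow> ?m" for c
    using tendsto_cadd_ereal[OF _ _ tendsto_ereal[OF lim_const_over_n[of c]], of ?m]
    by (simp add: zero_ereal_def[symmetric])
  have lim: "?f \<longlonglongrightarrow> ?m"
  proof (rule tendsto_sandwich[OF _ _ squeeze[of "- (a + b)"] squeeze[of "a + b"]])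
    show "\<forall>\<^sub>F k in sequentially. ereal (- (a + b) / real k) + ?m \<le> ?f k"
      using lower by (intro eventually_sequentiallyI[of 1]) (simp only: minus_divide_left)
    show "\<forall>\<^sub>F k in sequentially. ?f k \<le> ereal ((a + b) / real k) + ?m"
      using upper by (intro eventually_sequentiallyI[of 1])
  qed
  have "?f k \<le> markov_exponent q" if k: "k \<ge> 1" for k
  proof -
    have "?f k \<le> ereal (1 / real k) * (ereal (real k) * markov_exponent q)"
      by (intro ereal_mult_left_mono m_order_le_mult_markov_exponent[OF assms(1) k]) auto
    also have "\<dots> = markov_exponent q"
      using k by (simp add: mult.assoc[symmetric] one_ereal_def[symmetric])
    finally show ?thesis .
  qed
  then have "?m \<le> markov_exponent q"
    by (intro LIMSEQ_le_const2[OF lim]) auto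
  then show ?thesis
    using lim lim_imp_Limsup[OF _ lim] by (simp add: asymptotic_exponent_def)
qed

end
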